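(* Let $X$ be a separable metric space, let $x=(x_n)_{n\ge 1}$ be a sequence taking values in $X$, and let $\mathcal{I}$ be an Erdős–Ulam ideal on $\mathbf{N}$. Then: (i) the set $\{\omega\in(0,1]: \Gamma_{x\upharpoonright\omega}(\mathcal{I})=\Gamma_x(\mathcal{I})\}$ is not meager if and only if $\Gamma_x(\mathcal{I})=\mathrm{L}_x$; (ii) the set $\{\omega\in(0,1]: \Lambda_{x\upharpoonright\omega}(\mathcal{I})=\Lambda_x(\mathcal{I})\}$ is not meager if and only if $\Lambda_x(\mathcal{I})=\mathrm{L}_x$.
   Context: $\mathbf{N}$ is the set of positive integers. An Erdős–Ulam ideal is a family of the form $\mathrm{Exh}(\varphi_f)=\{A\subseteq\mathbf{N}: \lim_{n\to\infty}\varphi_f(A\setminus[1,n])=0\}$, where $f:\mathbf{N}\to(0,\infty)$ satisfies $\sum_{n\in\mathbf{N}}f(n)=\infty$ and $f(n)=o\left(\sum_{i\le n}f(i)\right)$ as $n\to\infty$, and $$\varphi_f(A)=\sup_{n\in\mathbf{N}}\frac{\sum_{i\le n,\,i\in A}f(i)}{\sum_{i\le n}f(i)}\qquad(A\subseteq\mathbf{N}).$$ For a sequence $x=(x_n)$ in $X$ and $\mathcal{I}\subseteq\mathcal{P}(\mathbf{N})$: $\Gamma_x(\mathcal{I})$ is the set of $\mathcal{I}$-cluster points of $x$, i.e. all $\ell\in X$ such that $\{n: x_n\in U\}\notin\mathcal{I}$ for every neighborhood $U$ of $\ell$; $\Lambda_x(\mathcal{I})$ is the set of $\mathcal{I}$-limit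 points of $x$, i.e. all $\ell\in X$ for which there is a subsequence $(x_{n_k})$ converging to $\ell$ with $\{n_k: k\in\mathbf{N}\}\notin\mathcal{I}$; $\mathrm{L}_x$ is the set of ordinary limit points of $x$ (limits of subsequences of $x$). For $\omega\in(0,1]$ let $\sum_{i\ge1}d_i(\omega)2^{-i}$ be its unique non-terminating dyadic expansion, $d_i(\omega)\in\{0,1\}$ (infinitely many digits equal to $1$). If $n_1<n_2<\cdots$ enumerates $\{i: d_i(\omega)=1\}$, then $x\upharpoonright\omega$ denotes the subsequence $(x_{n_k})_{k\ge1}$, regarded as a sequence indexed by $k\in\mathbf{N}$. Meager (first category) refers to $(0,1]$ with its usual topology. *)

theory Defs
  imports "HOL-Analysis.Analysis" "HOL-Library.Landau_Symbols" "HOL-Library.Infinite_Set"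
begin

text \<open>The set of positive integers is rendered as \<open>{1..} :: nat set\<close>: families of sets of positive
  integers have type \<open>nat set set\<close>, and sequences indexed by the positive integers are functions
  on \<open>nat\<close> whose value at \<open>0\<close> is never used.\<close>

definition weight_submeasure :: "(nat \<Rightarrow> real) \<Rightarrow> nat set \<Rightarrow> real" where
  "weight_submeasure f A = (SUP n\<in>{1..}. (\<Sum>i\<in>{1..n} \<inter> A. f i) / (\<Sum>i\<in>{1..n}. f i))"

definition Exh :: "(nat set \<Rightarrow> real) \<Rightarrow> nat set set" where
  "Exh \<phi> = {A. A \<subseteq> {1..} \<and> (\<lambda>n. \<phi> (A - {1..n})) \<longlonglongrightarrow> 0}"

definition erdos_ulam_ideal :: "nat set set \<Rightarrow> bool" where
  "erdos_ulam_ideal I \<longleftrightarrow>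
     (\<exists>f :: nat \<Rightarrow> real. (\<forall>n\<ge>1. f n > 0) \<and>
        filterlim (\<lambda>n. \<Sum>i\<in>{1..n}. f i) at_top sequentially \<and>
        f \<in> o(\<lambda>n. \<Sum>i\<in>{1..n}. f i) \<and>
        I = Exh (weight_submeasure f))"

definition cluster_points :: "nat set set \<Rightarrow> (nat \<Rightarrow> 'a::topological_space) \<Rightarrow> 'a set" where
  "cluster_points I x = {l. \<forall>U. l \<in> interior U \<longrightarrow> {n\<in>{1..}. x n \<in> U} \<notin> I}"

text \<open>\<open>s k\<close> plays the role of the index \<open>n\<^sub>k\<close>, for \<open>k \<ge> 1\<close>.\<close>

definition index_sequence :: "(nat \<Rightarrow> nat) \<Rightarrow> bool" where
  "index_sequence s \<longleftrightarrow> s ` {1..} \<subseteq> {1..} \<and> strict_mono_on {1..} s"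

definition ideal_limit_points :: "nat set set \<Rightarrow> (nat \<Rightarrow> 'a::topological_space) \<Rightarrow> 'a set" where
  "ideal_limit_points I x =
     {l. \<exists>s. index_sequence s \<and> (\<lambda>k. x (s k)) \<longlonglongrightarrow> l \<and> s ` {1..} \<notin> I}"

definition limit_points :: "(nat \<Rightarrow> 'a::topological_space) \<Rightarrow> 'a set" where
  "limit_points x = {l. \<exists>s. index_sequence s \<and> (\<lambda>k. x (s k)) \<longlonglongrightarrow> l}"

text \<open>Digits are numbered from \<open>1\<close>; the convention \<open>d 0 = 0\<close> makes the digit function unique on all
  of \<open>nat\<close> and removes the term \<open>i = 0\<close> from the series.\<close>

definition nonterminating_dyadic :: "real \<Rightarrow> (nat \<Rightarrow> nat) \<Rightarrow> bool" where
  "nonterminating_dyadic \<omega> d \<longleftrightarrow>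
     d 0 = 0 \<and> (\<forall>i. d i \<in> {0, 1}) \<and> infinite {i. d i = 1} \<and>
     (\<lambda>i. real (d i) / 2 ^ i) sums \<omega>"

definition dyadic_digit :: "real \<Rightarrow> nat \<Rightarrow> nat" where
  "dyadic_digit \<omega> = (THE d. nonterminating_dyadic \<omega> d)"

lemma nonterminating_dyadic_ceiling:
  assumes "nonterminating_dyadic \<omega> d"
  shows "(\<Sum>i\<le>n. real (d i) / 2 ^ i) = of_int (\<lceil>2 ^ n * \<omega>\<rceil> - 1) / 2 ^ n"
proof -
  define S where "S = (\<lambda>n. \<Sum>i\<le>n. real (d i) / 2 ^ i)"
  have d0: "d 0 = 0" and d01: "d i = 0 \<or> d i = 1" and inf: "infinite {i. d i = 1}"
    and sums: "(\<lambda>i. real (d i) / 2 ^ i) sums \<omega>" for i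
    using assms by (auto simp: nonterminating_dyadic_def)
  have lim: "S \<longlonglongrightarrow> \<omega>"
    using sums by (simp add: sums_def_le S_def)
  have S_Suc: "S (Suc m) = S m + real (d (Suc m)) / 2 ^ Suc m" for m
    by (simp add: S_def)
  have "incseq S"
    by (rule incseq_SucI) (simp add: S_Suc)
  have upper: "S m + 1 / 2 ^ m \<le> S n + 1 / 2 ^ n" if "n \<le> m" for m
    using that
  proof (induction m rule: dec_induct)
    case (step m)
    have "S (Suc m) + 1 / 2 ^ Suc m \<le> S m + 1 / 2 ^ m"
      using d01[of "Suc m"] by (auto simp: S_Suc field_simps)
    with step show ?case by linarith
  qed simp
  have "\<omega> \<le> S n + 1 / 2 ^ n"
  proof (rule LIMSEQ_le_const2[OF lim])
    have "S m \<le> S n + 1 / 2 ^ n" if "n \<le> m" for m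
      using upper[OF that] zero_le_divide_1_iff[of "(2::real) ^ m"] by (smt (verit) zero_le_power)
    then show "\<exists>N. \<forall>m\<ge>N. S m \<le> S n + 1 / 2 ^ n" by blast
  qed
  moreover have "S n < \<omega>"
  proof -
    obtain m where m: "m > n" "d m = 1"
      using inf by (auto simp: infinite_nat_iff_unbounded)
    then obtain k where k: "m = Suc k" by (cases m) auto
    have "S n \<le> S k"
      using \<open>incseq S\<close> m(1) k by (simp add: incseq_def)
    also have "\<dots> < S m" using m(2) by (simp add: k S_Suc)
    also have "\<dots> \<le> \<omega>" using \<open>incseq S\<close> lim by (rule incseq_le)
    finally show ?thesis .
  qed
  moreover have "\<exists>a::int. 2 ^ n * S n = of_int a"
  proof (induction n)
    case 0
    then show ?case by (simp add: S_def d0)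
  next
    case (Suc n)
    then obtain a :: int where a: "2 ^ n * S n = of_int a" by blast
    have "2 ^ Suc n * S (Suc n) = 2 * (2 ^ n * S n) + real (d (Suc n))"
      by (simp add: S_Suc algebra_simps)
    also have "\<dots> = of_int (2 * a + int (d (Suc n)))"
      by (simp add: a)
    finally show ?case by blast
  qed
  then obtain a :: int where a: "2 ^ n * S n = of_int a" by blast
  ultimately have "of_int a < 2 ^ n * \<omega>" "2 ^ n * \<omega> \<le> of_int (a + 1)"
    by (auto simp flip: a simp: field_simps)
  then have "\<lceil>2 ^ n * \<omega>\<rceil> = a + 1"
    by (intro ceiling_unique) auto
  then show ?thesis
    using a by (simp add: S_def field_simps)
qed

lemma ex1_nonterminating_dyadic:
  assumes "\<omega> \<in> {0<..1}"
  shows "\<exists>!d. nonterminating_dyadic \<omega> d"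
proof (rule ex_ex1I)
  define a where "a = (\<lambda>n::nat. \<lceil>2 ^ n * \<omega>\<rceil> - 1)"
  define d where "d = (\<lambda>n. case n of 0 \<Rightarrow> 0 | Suc k \<Rightarrow> nat (a (Suc k) - 2 * a k))"
  have step: "a (Suc k) - 2 * a k \<in> {0, 1}" for k
  proof -
    have "\<lceil>2 ^ Suc k * \<omega>\<rceil> = \<lceil>2 * (2 ^ k * \<omega>)\<rceil>" by (simp add: mult.assoc)
    then show ?thesis unfolding a_def by (simp; linarith)
  qed
  have a0: "a 0 = 0"
    using assms by (simp add: a_def ceiling_eq_iff)
  have S: "(\<Sum>i\<le>n. real (d i) / 2 ^ i) = of_int (a n) / 2 ^ n" for n
  proof (induction n)
    case (Suc n)
    have "real (d (Suc n)) = of_int (a (Suc n) - 2 * a n)"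
      using step[of n] by (auto simp: d_def)
    with Suc show ?case by (simp add: field_simps)
  qed (simp add: d_def a0)
  have bounds: "of_int (a n) / 2 ^ n < \<omega>" "\<omega> \<le> of_int (a n) / 2 ^ n + 1 / 2 ^ n" for n
  proof -
    have "of_int (a n) < 2 ^ n * \<omega>" "2 ^ n * \<omega> \<le> of_int (a n) + 1"
      unfolding a_def by linarith+
    then show "of_int (a n) / 2 ^ n < \<omega>" "\<omega> \<le> of_int (a n) / 2 ^ n + 1 / 2 ^ n"
      by (simp_all add: field_simps)
  qed
  have lower: "(\<lambda>n. \<omega> - 1 / 2 ^ n) \<longlonglongrightarrow> \<omega> - 0"
    by (intro tendsto_intros) (use LIMSEQ_inverse_realpow_zero[of 2] in \<open>simp add: inverse_eq_divide\<close>)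
  have "(\<lambda>n. of_int (a n) / 2 ^ n) \<longlonglongrightarrow> \<omega>"
  proof (rule tendsto_sandwich[OF _ _ lower[simplified] tendsto_const])
    show "\<forall>\<^sub>F n in sequentially. \<omega> - 1 / 2 ^ n \<le> of_int (a n) / 2 ^ n"
      using bounds(2) by (intro always_eventually) (simp add: diff_le_eq)
    show "\<forall>\<^sub>F n in sequentially. of_int (a n) / 2 ^ n \<le> \<omega>"
      using bounds(1) by (intro always_eventually) (simp add: less_imp_le)
  qed
  then have sums: "(\<lambda>i. real (d i) / 2 ^ i) sums \<omega>"
    by (simp add: sums_def_le S)
  have d01: "d i \<in> {0, 1}" for i
    using step[of "i - 1"] by (cases i) (auto simp: d_def)
  have "infinite {i. d i = 1}"
  proof
    assume "finite {i. d i = 1}"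
    then obtain N where N: "\<forall>i\<in>{i. d i = 1}. i \<le> N"
      using finite_nat_set_iff_bounded_le by blast
    have "d i = 0" if "i \<notin> {..N}" for i
      using that N d01[of i] by auto
    then have "(\<lambda>i. real (d i) / 2 ^ i) sums (\<Sum>i\<le>N. real (d i) / 2 ^ i)"
      by (intro sums_finite) auto
    with sums have "\<omega> = of_int (a N) / 2 ^ N"
      by (metis S sums_unique2)
    with bounds(1)[of N] show False by simp
  qed
  with sums d01 show "\<exists>d. nonterminating_dyadic \<omega> d"
    by (intro exI[of _ d]) (auto simp: nonterminating_dyadic_def d_def)
next
  fix d e assume d: "nonterminating_dyadic \<omega> d" and e: "nonterminating_dyadic \<omega> e"
  note eq = nonterminating_dyadic_ceiling[OF d, folded nonterminating_dyadic_ceiling[OF e]]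
  show "d = e"
  proof
    fix n
    show "d n = e n"
    proof (cases n)
      case 0
      then show ?thesis using d e by (simp add: nonterminating_dyadic_def)
    next
      case (Suc k)
      then show ?thesis using eq[of k] eq[of "Suc k"] by simp
    qed
  qed
qed

text \<open>\<open>enumerate\<close> counts from \<open>0\<close>, whereas the resulting subsequence is again indexed from \<open>1\<close>.\<close>

definition dyadic_subseq :: "(nat \<Rightarrow> 'a) \<Rightarrow> real \<Rightarrow> nat \<Rightarrow> 'a" where
  "dyadic_subseq x \<omega> k = x (enumerate {i. dyadic_digit \<omega> i = 1} (k - 1))"

definition nowhere_dense_in :: "'a topology \<Rightarrow> 'a set \<Rightarrow> bool" where
  "nowhere_dense_in T S \<longleftrightarrow> S \<subseteq> topspace T \<and> T interior_of (T closure_of S) = {}"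

definition meager_in :: "'a topology \<Rightarrow> 'a set \<Rightarrow> bool" where
  "meager_in T S \<longleftrightarrow> (\<exists>\<F>. countable \<F> \<and> (\<forall>N\<in>\<F>. nowhere_dense_in T N) \<and> S = \<Union>\<F>)"

end

theory Submission
  imports Defs
begin

text \<open>
  Both parts follow from one statement: for all \<open>\<omega>\<close> outside a meager set, the set of ideal limit
  points and the set of ideal cluster points of \<open>x \<restriction> \<omega>\<close> are both equal to the set \<open>L\<close> of ordinary limit
  points of \<open>x\<close>. Given this, the set of \<open>\<omega>\<close> at which one of these two sets is equal to a prescribed set
  \<open>K\<close> is comeager if \<open>K = L\<close> and meager otherwise, and a comeager subset of \<open>(0,1]\<close> is not meager by the Baire category theorem (\<open>not_meager_iff_generic_value\<close>).

  For every \<open>\<omega>\<close> there is the chain: ideal limit points of \<open>x \<restriction> \<omega>\<close>, ideal cluster points of \<open>x \<restriction> \<omega>\<close>,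
  limit points of \<open>x \<restriction> \<omega>\<close>, limit points of \<open>x\<close>, each set included in the next. So it suffices that
  generically every \<open>l \<in> L\<close> is an ideal limit point of \<open>x \<restriction> \<omega>\<close>
  (\<open>meager_not_limit_points_subset\<close>). This has two ingredients.

  \<^item> \<^emph>\<open>Category\<close> (\<open>nowhere_dense_sparse_selection\<close>). Let \<open>E\<close> be an infinite set of indices. Any finite
  block of digits of \<open>\<omega>\<close> can be continued by selecting only indices from \<open>E\<close>. As the total weight
  diverges, a long enough continuation makes the indices from \<open>E\<close> carry at least half of the
  weight of an initial segment of the subsequence. Hence a generic \<open>\<omega>\<close> gives the positions of elements
  of \<open>E\<close> weighted upper density at least \<open>1 / 2\<close>. By separability it is enough to use this for countably
  many sets \<open>E = {n. x n \<in> ball c r}\<close>, with \<open>c\<close> in a countable dense set and \<open>r = 1 / (q + 1)\<close>.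

  \<^item> \<^emph>\<open>Diagonalisation\<close> (\<open>ex_almost_subset_not_in_Exh\<close>). If decreasing sets all have weighted upper density
  at least \<open>c > 0\<close>, then a single set outside the ideal is contained in each of them up to finitely
  many elements. Applied to the position sets of the balls around \<open>l\<close>, this gives one set of positions
  outside the ideal along which \<open>x \<restriction> \<omega>\<close> converges to \<open>l\<close>.
\<close>

section \<open>Dyadic expansions and sets of digits\<close>

definition dyadic_support :: "real \<Rightarrow> nat set" where
  "dyadic_support \<omega> = {i. dyadic_digit \<omega> i = 1}"

lemma nonterminating_dyadic_digit:
  assumes "\<omega> \<in> {0<..1}"
  shows "nonterminating_dyadic \<omega> (dyadic_digit \<omega>)"
  unfolding dyadic_digit_def by (rule theI'[OF ex1_nonterminating_dyadic[OF assms]])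

lemma infinite_dyadic_support: "\<omega> \<in> {0<..1} \<Longrightarrow> infinite (dyadic_support \<omega>)"
  and dyadic_support_positive: "\<omega> \<in> {0<..1} \<Longrightarrow> dyadic_support \<omega> \<subseteq> {1..}"
proof -
  assume "\<omega> \<in> {0<..1}"
  note d = nonterminating_dyadic_digit[OF this]
  show "infinite (dyadic_support \<omega>)"
    using d by (simp add: nonterminating_dyadic_def dyadic_support_def)
  have "0 \<notin> dyadic_support \<omega>"
    using d by (simp add: nonterminating_dyadic_def dyadic_support_def)
  then show "dyadic_support \<omega> \<subseteq> {1..}"
    by (auto simp: Suc_le_eq intro: gr0I)
qed

lemma nonterminating_dyadic_range:
  assumes "nonterminating_dyadic \<omega> d"
  shows "\<omega> \<in> {0<..1}"
proof -
  have "\<lceil>\<omega>\<rceil> = 1"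
    using nonterminating_dyadic_ceiling[OF assms, of 0] assms
    by (simp add: nonterminating_dyadic_def)
  then show ?thesis by (simp add: ceiling_eq_iff)
qed

lemma ex_dyadic_support:
  assumes "infinite S" "S \<subseteq> {1..}"
  shows "\<exists>\<omega>\<in>{0<..1}. dyadic_support \<omega> = S"
proof -
  define d :: "nat \<Rightarrow> nat" where "d = (\<lambda>i. if i \<in> S then 1 else 0)"
  define \<omega> where "\<omega> = (\<Sum>i. real (d i) / 2 ^ i)"
  have "summable (\<lambda>i. real (d i) / 2 ^ i)"
  proof (rule summable_comparison_test')
    show "summable (\<lambda>i. (1 / 2) ^ i :: real)" by (rule summable_geometric) simp
    show "norm (real (d i) / 2 ^ i) \<le> (1 / 2) ^ i" if "i \<ge> 0" for i
      by (simp add: d_def power_divide)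
  qed
  then have d: "nonterminating_dyadic \<omega> d"
    using assms by (auto simp: nonterminating_dyadic_def \<omega>_def d_def)
  have \<omega>: "\<omega> \<in> {0<..1}" by (rule nonterminating_dyadic_range[OF d])
  then have "dyadic_digit \<omega> = d"
    using d ex1_nonterminating_dyadic nonterminating_dyadic_digit by blast
  then have "dyadic_support \<omega> = S"
    by (auto simp: dyadic_support_def d_def)
  with \<omega> show ?thesis by blast
qed

text \<open>The \<open>m\<close>-th partial sum of the expansion is \<open>(\<lceil>2 ^ m * \<omega>\<rceil> - 1) / 2 ^ m\<close>, so the first \<open>n\<close> digits and the
  first \<open>n\<close> of these ceilings carry the same information. This turns statements on digits into
  statements on the order of the reals.\<close>

lemma dyadic_support_initial_iff:
  assumes "\<omega> \<in> {0<..1}" "\<omega>' \<in> {0<..1}"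
  shows "dyadic_support \<omega> \<inter> {..n} = dyadic_support \<omega>' \<inter> {..n} \<longleftrightarrow>
    (\<forall>m\<le>n. \<lceil>2 ^ m * \<omega>\<rceil> = \<lceil>2 ^ m * \<omega>'\<rceil>)"
proof -
  define d e where "d = dyadic_digit \<omega>" and "e = dyadic_digit \<omega>'"
  have d: "nonterminating_dyadic \<omega> d" and e: "nonterminating_dyadic \<omega>' e"
    using assms by (simp_all add: d_def e_def nonterminating_dyadic_digit)
  have d01: "d i = 0 \<or> d i = 1" and e01: "e i = 0 \<or> e i = 1" for i
    using d e by (auto simp: nonterminating_dyadic_def)
  have "dyadic_support \<omega> \<inter> {..n} = dyadic_support \<omega>' \<inter> {..n} \<longleftrightarrow> (\<forall>i\<le>n. d i = e i)"
    using d01 e01 unfolding dyadic_support_def d_def[symmetric] e_def[symmetric] set_eq_iff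
    by simp (metis zero_neq_one)
  also have "\<dots> \<longleftrightarrow> (\<forall>m\<le>n. (\<Sum>i\<le>m. real (d i) / 2 ^ i) = (\<Sum>i\<le>m. real (e i) / 2 ^ i))"
  proof
    assume *: "\<forall>m\<le>n. (\<Sum>i\<le>m. real (d i) / 2 ^ i) = (\<Sum>i\<le>m. real (e i) / 2 ^ i)"
    show "\<forall>i\<le>n. d i = e i"
    proof (intro allI impI)
      fix i assume "i \<le> n"
      then show "d i = e i"
        using *[rule_format, of i] *[rule_format, of "i - 1"] by (cases i) auto
    qed
  qed (auto intro!: sum.cong)
  also have "\<dots> \<longleftrightarrow> (\<forall>m\<le>n. \<lceil>2 ^ m * \<omega>\<rceil> = \<lceil>2 ^ m * \<omega>'\<rceil>)"
    by (simp add: nonterminating_dyadic_ceiling[OF d] nonterminating_dyadic_ceiling[OF e])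
  finally show ?thesis .
qed

lemma dyadic_support_initial_imp_close:
  assumes "\<omega> \<in> {0<..1}" "\<omega>' \<in> {0<..1}"
    and "dyadic_support \<omega> \<inter> {..n} = dyadic_support \<omega>' \<inter> {..n}"
  shows "\<bar>\<omega> - \<omega>'\<bar> < 1 / 2 ^ n"
proof -
  have "\<lceil>2 ^ n * \<omega>\<rceil> = \<lceil>2 ^ n * \<omega>'\<rceil>"
    using assms dyadic_support_initial_iff by blast
  then have "\<bar>2 ^ n * (\<omega> - \<omega>')\<bar> < 1" unfolding right_diff_distrib by linarith
  then show ?thesis
    by (simp add: abs_mult less_divide_eq mult.commute)
qed

lemma eventually_at_left_ceiling_eq:
  fixes a c :: real
  assumes "c > 0"
  shows "\<forall>\<^sub>F t in at_left a. \<lceil>c * t\<rceil> = \<lceil>c * a\<rceil>"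
proof -
  define b where "b = (of_int \<lceil>c * a\<rceil> - 1) / c"
  have "b < a" using assms unfolding b_def by (simp add: divide_less_eq mult.commute) linarith
  then have "\<forall>\<^sub>F t in at_left a. b < t \<and> t < a"
    by (auto simp: eventually_at_left)
  then show ?thesis
  proof eventually_elim
    case (elim t)
    have "of_int \<lceil>c * a\<rceil> - 1 < c * t"
      using elim assms by (simp add: b_def divide_less_eq mult.commute)
    moreover have "c * t \<le> of_int \<lceil>c * a\<rceil>"
      using elim assms mult_left_mono[of t a c] by linarith
    ultimately show ?case by (intro ceiling_unique)
  qed
qed

text \<open>Digits are continuous from the left only: just to the right of a dyadic rational the
  initial digits change. This is due to the choice of the non-terminating expansion, which makes the
  ceilings above the relevant functions.\<close>

lemma eventually_at_left_dyadic_support: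
  assumes "\<omega> \<in> {0<..1}"
  shows "\<forall>\<^sub>F t in at_left \<omega>. t \<in> {0<..1} \<and> dyadic_support t \<inter> {..n} = dyadic_support \<omega> \<inter> {..n}"
proof -
  have "\<forall>\<^sub>F t in at_left \<omega>. 0 < t \<and> t < \<omega>"
    using assms by (auto simp: eventually_at_left intro: exI[of _ 0])
  moreover have "\<forall>\<^sub>F t in at_left \<omega>. \<forall>m\<in>{..n}. \<lceil>2 ^ m * t\<rceil> = \<lceil>2 ^ m * \<omega>\<rceil>"
    by (intro eventually_ball_finite ballI eventually_at_left_ceiling_eq) auto
  ultimately show ?thesis
  proof eventually_elim
    case (elim t)
    then have "t \<in> {0<..1}" using assms by auto
    with elim dyadic_support_initial_iff[OF this assms] show ?case by auto
  qed
qed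

text \<open>Transfer of category arguments from infinite sets of positive integers to \<open>(0,1]\<close>: a
  property that is decided by finitely many digits, and that can be achieved after any finite block of
  digits, fails only on a nowhere dense set. Since a digit cylinder need not be a
  neighbourhood of each of its points, the proof finds an open interval to the left of a suitable
  point \<open>\<xi>\<close> instead of a neighbourhood of \<open>\<xi>\<close>.\<close>

lemma nowhere_dense_dyadic_support:
  fixes Q :: "nat set \<Rightarrow> bool"
  assumes finitely_determined: "\<And>S. infinite S \<Longrightarrow> Q S \<Longrightarrow>
      \<exists>n. \<forall>T. infinite T \<longrightarrow> T \<inter> {..n} = S \<inter> {..n} \<longrightarrow> Q T"
    and extendable: "\<And>S n. infinite S \<Longrightarrow> S \<subseteq> {1..} \<Longrightarrow>
      \<exists>T. infinite T \<and> T \<subseteq> {1..} \<and> T \<inter> {..n} = S \<inter> {..n} \<and> Q T"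
  shows "nowhere_dense_in (top_of_set {0<..1}) {\<omega>\<in>{0<..1}. \<not> Q (dyadic_support \<omega>)}"
proof -
  let ?T = "top_of_set {0<..1::real}"
  let ?S = "{\<omega>\<in>{0<..1}. \<not> Q (dyadic_support \<omega>)}"
  have False if "\<omega> \<in> ?T interior_of (?T closure_of ?S)" for \<omega>
  proof -
    have "openin ?T (?T interior_of (?T closure_of ?S))" by (rule openin_interior_of)
    then obtain V where V: "open V" "?T interior_of (?T closure_of ?S) = {0<..1} \<inter> V"
      unfolding openin_open by blast
    have \<omega>: "\<omega> \<in> {0<..1}" "\<omega> \<in> V" using that V by auto
    then obtain \<epsilon> where \<epsilon>: "\<epsilon> > 0" "ball \<omega> \<epsilon> \<subseteq> V"
      using V(1) open_contains_ball by blast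
    obtain n where n: "(1 / 2) ^ n < \<epsilon>"
      using real_arch_pow_inv[OF \<epsilon>(1), of "1 / 2"] by auto
    obtain S where S: "infinite S" "S \<subseteq> {1..}" "S \<inter> {..n} = dyadic_support \<omega> \<inter> {..n}" "Q S"
      using extendable[OF infinite_dyadic_support dyadic_support_positive] \<omega>(1) by blast
    obtain \<xi> where \<xi>: "\<xi> \<in> {0<..1}" "dyadic_support \<xi> = S"
      using ex_dyadic_support[OF S(1,2)] by blast
    have "\<bar>\<xi> - \<omega>\<bar> < 1 / 2 ^ n"
      using dyadic_support_initial_imp_close[OF \<xi>(1) \<omega>(1)] S(3) \<xi>(2) by blast
    also have "\<dots> < \<epsilon>" using n by (simp add: power_divide)
    finally have "\<xi> \<in> V" using \<epsilon>(2) by (auto simp: dist_real_def abs_minus_commute)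
    \<comment> \<open>The property persists on an open interval with right end point \<open>\<xi>\<close>, inside \<open>V\<close>.\<close>
    obtain p where p: "\<And>T. infinite T \<Longrightarrow> T \<inter> {..p} = S \<inter> {..p} \<Longrightarrow> Q T"
      using finitely_determined[OF S(1,4)] by blast
    have "\<forall>\<^sub>F t in at_left \<xi>. t \<in> V"
      using topological_tendstoD[OF tendsto_ident_at V(1) \<open>\<xi> \<in> V\<close>] .
    with eventually_at_left_dyadic_support[OF \<xi>(1), of p]
    have "\<forall>\<^sub>F t in at_left \<xi>. t \<in> {0<..1} \<inter> V \<and> t \<notin> ?S"
    proof eventually_elim
      case (elim t)
      then show ?case using p infinite_dyadic_support[of t] \<xi>(2) by auto
    qed
    then obtain b where b: "b < \<xi>" "\<And>t. b < t \<Longrightarrow> t < \<xi> \<Longrightarrow> t \<in> {0<..1} \<inter> V \<and> t \<notin> ?S"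
      unfolding eventually_at_left_field by blast
    obtain t where t: "b < t" "t < \<xi>" using dense[OF b(1)] by blast
    have "t \<in> ?T closure_of ?S"
      using b(2)[OF t] V(2) interior_of_subset[of ?T "?T closure_of ?S"] by blast
    moreover have "openin ?T {b<..<\<xi>}"
      using b(2) by (intro open_subset) auto
    ultimately obtain u where "u \<in> ?S" "u \<in> {b<..<\<xi>}"
      using t unfolding in_closure_of by (metis greaterThanLessThan_iff)
    then show False using b(2)[of u] by auto
  qed
  then show ?thesis
    by (auto simp: nowhere_dense_in_def)
qed

section \<open>Meager subsets of the half-open unit interval\<close>

lemma meager_in_subset:
  assumes "meager_in T S" "R \<subseteq> S"
  shows "meager_in T R"
proof -
  obtain \<F> where \<F>: "countable \<F>" "\<And>N. N \<in> \<F> \<Longrightarrow> nowhere_dense_in T N" "S = \<Union>\<F>"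
    using assms(1) by (auto simp: meager_in_def)
  have "nowhere_dense_in T (N \<inter> R)" if "N \<in> \<F>" for N
  proof -
    have "T interior_of (T closure_of (N \<inter> R)) \<subseteq> T interior_of (T closure_of N)"
      by (intro interior_of_mono closure_of_mono) auto
    then show ?thesis using \<F>(2)[OF that] by (auto simp: nowhere_dense_in_def)
  qed
  then show ?thesis
    unfolding meager_in_def using \<F>(1,3) assms(2)
    by (intro exI[of _ "(\<lambda>N. N \<inter> R) ` \<F>"]) auto
qed

lemma meager_in_Un:
  assumes "meager_in T S" "meager_in T R"
  shows "meager_in T (S \<union> R)"
proof -
  obtain \<F> \<G> where "countable \<F>" "\<forall>N\<in>\<F>. nowhere_dense_in T N" "S = \<Union>\<F>"
    "countable \<G>" "\<forall>N\<in>\<G>. nowhere_dense_in T N" "R = \<Union>\<G>"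
    using assms unfolding meager_in_def by blast
  then show ?thesis
    unfolding meager_in_def by (intro exI[of _ "\<F> \<union> \<G>"]) auto
qed

text \<open>The interval is not closed in the reals, but it is locally compact, being closed in the open
  half-line; so the Baire category theorem for locally compact regular spaces applies.\<close>

lemma not_meager_half_open_interval: "\<not> meager_in (top_of_set {0<..1::real}) {0<..1}"
proof
  let ?T = "top_of_set {0<..1::real}"
  assume "meager_in ?T {0<..1}"
  then obtain \<F> where \<F>: "countable \<F>" "\<And>N. N \<in> \<F> \<Longrightarrow> nowhere_dense_in ?T N" "{0<..1} = \<Union>\<F>"
    by (auto simp: meager_in_def)
  have *: "{0<..1} = {0<..} \<inter> {0<..1::real}" by auto
  have "closedin (top_of_set {0<..}) {0<..1::real}"
    by (auto simp: closedin_closed intro!: exI[of _ "{..1}"])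
  moreover have "locally_compact_space (top_of_set ({0<..} :: real set))"
    by (intro locally_compact_space_open_subset)
      (auto simp: locally_compact_space_euclidean regular_space_euclidean)
  ultimately have "locally_compact_space ?T"
    using locally_compact_space_closed_subset[of "top_of_set {0<..}" "{0<..1::real}"]
    by (simp add: subtopology_subtopology flip: *)
  moreover have "regular_space ?T"
    by (simp add: regular_space_subtopology regular_space_euclidean)
  ultimately have "?T interior_of \<Union>((closure_of) ?T ` \<F>) = {}"
    using \<F>(1,2) by (intro Baire_category_alt) (auto simp: nowhere_dense_in_def)
  moreover have "\<Union>((closure_of) ?T ` \<F>) = topspace ?T"
  proof
    show "\<Union>((closure_of) ?T ` \<F>) \<subseteq> topspace ?T"
      using closure_of_subset_topspace by fastforce
    show "topspace ?T \<subseteq> \<Union>((closure_of) ?T ` \<F>)"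
    proof
      fix t assume "t \<in> topspace ?T"
      then obtain N where "N \<in> \<F>" "t \<in> N" using \<F>(3) by auto
      moreover have "N \<subseteq> ?T closure_of N"
        using \<F>(2)[OF \<open>N \<in> \<F>\<close>] by (intro closure_of_subset) (auto simp: nowhere_dense_in_def)
      ultimately show "t \<in> \<Union>((closure_of) ?T ` \<F>)" by blast
    qed
  qed
  ultimately show False using interior_of_topspace[of ?T] by auto
qed

section \<open>Enumerations and limit points\<close>

lemma enumerate_eq_initial:
  fixes S T :: "nat set"
  assumes "infinite S" "infinite T"
    and init: "T \<inter> {..enumerate S n} = S \<inter> {..enumerate S n}"
    and "j \<le> n"
  shows "enumerate T j = enumerate S j"
  using \<open>j \<le> n\<close>
proof (induction j)
  case 0
  have "enumerate S 0 \<le> enumerate S n"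
    using assms(1) by simp
  moreover have "enumerate S 0 \<in> S" by (rule enumerate_in_set[OF assms(1)])
  ultimately have "enumerate S 0 \<in> T" using init by blast
  moreover have "enumerate S 0 \<le> y" if "y \<in> T" for y
  proof (cases "y \<le> enumerate S n")
    case True
    then have "y \<in> S" using init that by blast
    then show ?thesis by (simp add: enumerate_0 Least_le)
  qed (use \<open>enumerate S 0 \<le> enumerate S n\<close> in linarith)
  ultimately show ?case
    unfolding enumerate_0[of T] by (intro Least_equality)
next
  case (Suc j)
  have le: "enumerate S (Suc j) \<le> enumerate S n"
    using assms(1) Suc.prems by simp
  moreover have "enumerate S (Suc j) \<in> S" by (rule enumerate_in_set[OF assms(1)])
  ultimately have "enumerate S (Suc j) \<in> T" using init by blast
  moreover have "enumerate S j < enumerate S (Suc j)"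
    using assms(1) by (simp add: enumerate_step)
  moreover have "enumerate S (Suc j) \<le> y" if "y \<in> T" "enumerate S j < y" for y
  proof (cases "y \<le> enumerate S n")
    case True
    then have "y \<in> S" using init that by blast
    then show ?thesis using that(2) assms(1) by (simp add: enumerate_Suc'' Least_le)
  qed (use le in linarith)
  moreover have "enumerate T j = enumerate S j" using Suc by simp
  ultimately show ?case
    unfolding enumerate_Suc''[OF assms(2)] by (intro Least_equality) auto
qed

lemma index_sequence_enumerate:
  assumes "infinite S" "S \<subseteq> {1..}"
  shows "index_sequence (\<lambda>k. enumerate S (k - 1))" "(\<lambda>k. enumerate S (k - 1)) ` {1..} = S"
proof -
  have "(\<lambda>k::nat. k - 1) ` {1..} = UNIV"
    by (auto simp: image_iff intro!: bexI[of _ "Suc _"])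
  then show *: "(\<lambda>k. enumerate S (k - 1)) ` {1..} = S"
    using range_enumerate[OF assms(1)] by (metis image_image)
  have "strict_mono_on {1..} (\<lambda>k. enumerate S (k - 1))"
    using assms(1) by (intro strict_mono_onI) (simp add: enumerate_mono)
  then show "index_sequence (\<lambda>k. enumerate S (k - 1))"
    using assms(2) * by (simp add: index_sequence_def)
qed

lemma index_sequence_compose:
  assumes "index_sequence s" "index_sequence t"
  shows "index_sequence (\<lambda>k. s (t k))"
  using assms unfolding index_sequence_def strict_mono_on_def by (auto simp: image_subset_iff)

lemma index_sequence_tendsto_infinity:
  assumes "index_sequence s"
  shows "filterlim s at_top sequentially"
proof -
  have "strict_mono (\<lambda>n. s (Suc n))"
    using assms by (auto simp: index_sequence_def strict_mono_def strict_mono_on_def)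
  then have "filterlim (\<lambda>n. s (Suc n)) at_top sequentially"
    by (rule filterlim_subseq)
  then show ?thesis by (simp add: filterlim_sequentially_Suc)
qed

lemma limit_points_compose_subset:
  assumes "index_sequence s"
  shows "limit_points (\<lambda>k. x (s k)) \<subseteq> limit_points x"
  using index_sequence_compose[OF assms] unfolding limit_points_def by blast

lemma almost_subset_imp_convergent_enumeration:
  fixes x :: "nat \<Rightarrow> 'a::metric_space"
  assumes A: "infinite A" "A \<subseteq> {1..}"
    and almost: "\<And>\<epsilon>. \<epsilon> > 0 \<Longrightarrow> finite (A - {n. x n \<in> ball l \<epsilon>})"
  shows "(\<lambda>k. x (enumerate A (k - 1))) \<longlonglongrightarrow> l"
proof (rule tendstoI)
  fix \<epsilon> :: real assume "\<epsilon> > 0"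
  then have "finite (A - {n. x n \<in> ball l \<epsilon>})" by (rule almost)
  then obtain b where b: "\<And>n. n \<in> A - {n. x n \<in> ball l \<epsilon>} \<Longrightarrow> n < b"
    unfolding finite_nat_set_iff_bounded by blast
  have "\<forall>\<^sub>F k in sequentially. b \<le> enumerate A (k - 1)"
    using index_sequence_tendsto_infinity[OF index_sequence_enumerate(1)[OF A]]
    by (simp add: filterlim_at_top)
  then show "\<forall>\<^sub>F k in sequentially. dist (x (enumerate A (k - 1))) l < \<epsilon>"
  proof eventually_elim
    case (elim k)
    have "enumerate A (k - 1) \<in> A" by (rule enumerate_in_set[OF A(1)])
    with b[of "enumerate A (k - 1)"] elim show ?case
      by (auto simp: dist_commute not_less[symmetric])
  qed
qed

text \<open>The description of limit points by index sets makes them comparable with cluster points, since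
  finite sets belong to the ideal.\<close>

lemma limit_points_iff_infinite_ball:
  fixes x :: "nat \<Rightarrow> 'a::metric_space"
  shows "l \<in> limit_points x \<longleftrightarrow> (\<forall>\<epsilon>>0. infinite {n\<in>{1..}. x n \<in> ball l \<epsilon>})"
proof
  assume "l \<in> limit_points x"
  then obtain s where s: "index_sequence s" "(\<lambda>k. x (s k)) \<longlonglongrightarrow> l"
    by (auto simp: limit_points_def)
  show "\<forall>\<epsilon>>0. infinite {n\<in>{1..}. x n \<in> ball l \<epsilon>}"
  proof (intro allI impI)
    fix \<epsilon> :: real assume "\<epsilon> > 0"
    have "\<exists>n\<ge>b. n \<in> {n\<in>{1..}. x n \<in> ball l \<epsilon>}" for b
    proof -
      have "\<forall>\<^sub>F k in sequentially. k \<ge> 1 \<and> b \<le> s k \<and> dist (x (s k)) l < \<epsilon>"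
        using index_sequence_tendsto_infinity[OF s(1)] tendstoD[OF s(2) \<open>\<epsilon> > 0\<close>]
          eventually_ge_at_top[of 1]
        by (auto simp: filterlim_at_top elim: eventually_elim2 intro!: eventually_conj)
      then obtain k where "k \<ge> 1 \<and> b \<le> s k \<and> dist (x (s k)) l < \<epsilon>"
        using eventually_happens'[OF sequentially_bot] by blast
      then show ?thesis
        using s(1) by (intro exI[of _ "s k"]) (auto simp: index_sequence_def dist_commute)
    qed
    then show "infinite {n\<in>{1..}. x n \<in> ball l \<epsilon>}"
      unfolding infinite_nat_iff_unbounded_le by blast
  qed
next
  assume *: "\<forall>\<epsilon>>0. infinite {n\<in>{1..}. x n \<in> ball l \<epsilon>}"
  have "\<exists>N::nat \<Rightarrow> nat. \<forall>k. (N k \<ge> 1 \<and> x (N k) \<in> ball l (1 / Suc k)) \<and> N k < N (Suc k)"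
  proof (rule dependent_nat_choice)
    show "\<exists>n. n \<ge> 1 \<and> x n \<in> ball l (1 / Suc 0)"
      using not_finite_existsD[OF *[rule_format, of "1 / Suc 0"]] by auto
    show "\<exists>m. (m \<ge> 1 \<and> x m \<in> ball l (1 / Suc (Suc k))) \<and> n < m" for n k
      using *[rule_format, of "1 / Suc (Suc k)"]
      unfolding infinite_nat_iff_unbounded by auto
  qed
  then obtain N where N: "\<And>k. N k \<ge> 1" "\<And>k. x (N k) \<in> ball l (1 / Suc k)"
    "\<And>k. N k < N (Suc k)"
    by blast
  have "strict_mono N" using N(3) by (rule strict_mono_Suc_iff[THEN iffD2, rule_format])
  then have "index_sequence N"
    using N(1) by (auto simp: index_sequence_def strict_mono_on_def strict_mono_def)
  moreover have "(\<lambda>k. x (N k)) \<longlonglongrightarrow> l"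
  proof (rule metric_LIMSEQ_I)
    fix \<epsilon> :: real assume "\<epsilon> > 0"
    then obtain m where m: "inverse (real (Suc m)) < \<epsilon>" using reals_Archimedean by blast
    have "dist (x (N k)) l < \<epsilon>" if "k \<ge> m" for k
    proof -
      have "dist (x (N k)) l < 1 / Suc k" using N(2)[of k] by (simp add: dist_commute)
      also have "\<dots> \<le> inverse (real (Suc m))" using that by (simp add: field_simps)
      finally show ?thesis using m by linarith
    qed
    then show "\<exists>m. \<forall>k\<ge>m. dist (x (N k)) l < \<epsilon>" by blast
  qed
  ultimately show "l \<in> limit_points x" by (auto simp: limit_points_def)
qed

section \<open>The ideal of a weight\<close>

locale positive_weight =
  fixes f :: "nat \<Rightarrow> real"
  assumes pos: "n \<ge> 1 \<Longrightarrow> 0 < f n"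
begin

lemma sum_nonneg': "A \<subseteq> {1..} \<Longrightarrow> 0 \<le> sum f A"
  by (intro sum_nonneg less_imp_le[OF pos]) auto

lemma sum_mono_subset: "finite B \<Longrightarrow> A \<subseteq> B \<Longrightarrow> B \<subseteq> {1..} \<Longrightarrow> sum f A \<le> sum f B"
  by (rule sum_mono2) (auto intro!: less_imp_le[OF pos])

text \<open>All ratios are at most \<open>1\<close>, so the supremum is taken over a bounded set; without this bound
  \<open>SUP\<close> would be an unspecified real number.\<close>

lemma ratio_le_weight_submeasure:
  assumes "n \<ge> 1"
  shows "sum f ({1..n} \<inter> A) / sum f {1..n} \<le> weight_submeasure f A"
proof -
  have "sum f ({1..n} \<inter> A) / sum f {1..n} \<le> 1" for n
  proof -
    have "sum f ({1..n} \<inter> A) \<le> sum f {1..n}" by (rule sum_mono_subset) auto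
    moreover have "0 \<le> sum f {1..n}" by (rule sum_nonneg') auto
    ultimately show ?thesis by (auto simp only: divide_le_eq_1 intro: order.not_eq_order_implies_strict[of 0])
  qed
  then show ?thesis
    unfolding weight_submeasure_def using assms
    by (intro cSUP_upper bdd_aboveI2[where M = 1]) auto
qed

lemma weight_submeasure_mono:
  assumes "A \<subseteq> B"
  shows "weight_submeasure f A \<le> weight_submeasure f B"
  unfolding weight_submeasure_def[of f A]
proof (rule cSUP_least)
  fix n :: nat assume n: "n \<in> {1..}"
  have "sum f ({1..n} \<inter> A) / sum f {1..n} \<le> sum f ({1..n} \<inter> B) / sum f {1..n}"
    using assms by (intro divide_right_mono sum_mono_subset sum_nonneg') auto
  also have "\<dots> \<le> weight_submeasure f B"
    using n by (intro ratio_le_weight_submeasure) auto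
  finally show "sum f ({1..n} \<inter> A) / sum f {1..n} \<le> weight_submeasure f B" .
qed simp

lemma weight_submeasure_empty: "weight_submeasure f {} = 0"
  by (simp add: weight_submeasure_def)

lemma weight_submeasure_nonneg: "0 \<le> weight_submeasure f A"
  using weight_submeasure_mono[of "{}" A] by (simp add: weight_submeasure_empty)

text \<open>Closure under subsets and under finite changes, the only properties of an ideal that enter
  the comparison of the different kinds of limit points.\<close>

lemma Exh_almost_subset:
  assumes "A \<in> Exh (weight_submeasure f)" "B \<subseteq> {1..}" "finite (B - A)"
  shows "B \<in> Exh (weight_submeasure f)"
proof -
  have A: "(\<lambda>n. weight_submeasure f (A - {1..n})) \<longlonglongrightarrow> 0"
    using assms(1) by (simp add: Exh_def)
  obtain b where b: "\<And>n. n \<in> B - A \<Longrightarrow> n < b"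
    using assms(3) unfolding finite_nat_set_iff_bounded by blast
  have "\<forall>\<^sub>F n in sequentially. weight_submeasure f (B - {1..n}) \<le> weight_submeasure f (A - {1..n})"
    using eventually_ge_at_top[of b]
  proof eventually_elim
    case (elim n)
    have "B - {1..n} \<subseteq> A - {1..n}"
      using elim assms(2) b by fastforce
    then show ?case by (rule weight_submeasure_mono)
  qed
  then have "(\<lambda>n. weight_submeasure f (B - {1..n})) \<longlonglongrightarrow> 0"
    by (intro tendsto_sandwich[OF _ _ tendsto_const A]) (auto simp: weight_submeasure_nonneg)
  then show ?thesis using assms(2) by (simp add: Exh_def)
qed

lemma finite_in_Exh: "finite A \<Longrightarrow> A \<subseteq> {1..} \<Longrightarrow> A \<in> Exh (weight_submeasure f)"
  by (rule Exh_almost_subset[of "{}"]) (auto simp: Exh_def weight_submeasure_empty)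

lemma ideal_limit_points_subset_cluster_points:
  "ideal_limit_points (Exh (weight_submeasure f)) y \<subseteq> cluster_points (Exh (weight_submeasure f)) y"
proof
  fix l assume "l \<in> ideal_limit_points (Exh (weight_submeasure f)) y"
  then obtain s where s: "index_sequence s" "(\<lambda>k. y (s k)) \<longlonglongrightarrow> l"
    "s ` {1..} \<notin> Exh (weight_submeasure f)"
    by (auto simp: ideal_limit_points_def)
  show "l \<in> cluster_points (Exh (weight_submeasure f)) y"
    unfolding cluster_points_def
  proof (intro CollectI allI impI notI)
    fix U assume U: "l \<in> interior U" "{n \<in> {1..}. y n \<in> U} \<in> Exh (weight_submeasure f)"
    have "\<forall>\<^sub>F k in sequentially. y (s k) \<in> interior U"
      using topological_tendstoD[OF s(2) open_interior U(1)] .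
    then obtain b where b: "\<And>k. k \<ge> b \<Longrightarrow> y (s k) \<in> U"
      using interior_subset unfolding eventually_sequentially by blast
    have "s ` {1..} - {n \<in> {1..}. y n \<in> U} \<subseteq> s ` {..b}"
      using b s(1) by (auto simp: index_sequence_def) (metis image_eqI atMost_iff nle_le)
    then have "finite (s ` {1..} - {n \<in> {1..}. y n \<in> U})"
      by (rule finite_subset) simp
    then have "s ` {1..} \<in> Exh (weight_submeasure f)"
      using s(1) by (intro Exh_almost_subset[OF U(2)]) (auto simp: index_sequence_def)
    with s(3) show False by blast
  qed
qed

lemma cluster_points_subset_limit_points:
  fixes y :: "nat \<Rightarrow> 'a::metric_space"
  shows "cluster_points (Exh (weight_submeasure f)) y \<subseteq> limit_points y"
proof
  fix l assume l: "l \<in> cluster_points (Exh (weight_submeasure f)) y"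
  show "l \<in> limit_points y"
    unfolding limit_points_iff_infinite_ball
  proof (intro allI impI)
    fix \<epsilon> :: real assume "\<epsilon> > 0"
    then have "{n\<in>{1..}. y n \<in> ball l \<epsilon>} \<notin> Exh (weight_submeasure f)"
      using l unfolding cluster_points_def by (simp add: interior_open[OF open_ball] del: mem_ball)
    then show "infinite {n\<in>{1..}. y n \<in> ball l \<epsilon>}"
      using finite_in_Exh by blast
  qed
qed

end

section \<open>Diagonalisation against the ideal\<close>

locale divergent_weight = positive_weight +
  assumes divergent: "filterlim (\<lambda>n. sum f {1..n}) at_top sequentially"
begin

text \<open>Choose cut points \<open>N 0 < N 1 < \<dots>\<close> such that \<open>B k\<close> carries a fixed proportion of the weight of
  \<open>{1..N (k + 1)}\<close> already inside the block \<open>{N k<..N (k + 1)}\<close>, and let \<open>A\<close> consist of the parts of the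
  \<open>B k\<close> in these blocks. Every tail of \<open>A\<close> contains entire blocks, so its submeasure stays bounded away
  from \<open>0\<close>; and only the finitely many blocks before the \<open>k\<close>-th can contribute to \<open>A - B k\<close>.\<close>

lemma ex_almost_subset_not_in_Exh:
  assumes "c > 0"
    and decreasing: "\<And>k. B (Suc k) \<subseteq> B k"
    and dense: "\<And>k. \<exists>\<^sub>F n in sequentially. c * sum f {1..n} \<le> sum f ({1..n} \<inter> B k)"
  shows "\<exists>A\<subseteq>{1..}. A \<notin> Exh (weight_submeasure f) \<and> (\<forall>k. finite (A - B k))"
proof -
  have "\<exists>N::nat \<Rightarrow> nat. \<forall>k. True \<and> (N k < N (Suc k) \<and>
    c / 2 * sum f {1..N (Suc k)} \<le> sum f ({N k<..N (Suc k)} \<inter> B k))"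
  proof (rule dependent_nat_choice)
    fix N k :: nat
    \<comment> \<open>By divergence the weight up to \<open>N\<close> is eventually at most \<open>c / 2\<close> of the whole; discarding it
      halves the proportion \<open>c\<close>.\<close>
    have "\<forall>\<^sub>F n in sequentially. N < n \<and> 2 / c * sum f {1..N} \<le> sum f {1..n}"
      using divergent eventually_gt_at_top[of N]
      by (auto simp: filterlim_at_top intro: eventually_conj)
    then obtain n where n: "c * sum f {1..n} \<le> sum f ({1..n} \<inter> B k)" "N < n"
      "2 / c * sum f {1..N} \<le> sum f {1..n}"
      using frequently_ex[OF frequently_eventually_frequently[OF dense[of k]]] by blast
    have "sum f ({1..n} \<inter> B k) = sum f ({1..N} \<inter> B k) + sum f ({N<..n} \<inter> B k)"
      using n(2) by (subst sum.union_disjoint[symmetric]) (auto intro!: sum.cong)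
    moreover have "sum f ({1..N} \<inter> B k) \<le> sum f {1..N}" by (rule sum_mono_subset) auto
    moreover have "sum f {1..N} \<le> c / 2 * sum f {1..n}"
      using n(3) \<open>c > 0\<close> by (simp add: field_simps)
    ultimately have "c / 2 * sum f {1..n} \<le> sum f ({N<..n} \<inter> B k)"
      using n(1) by (simp add: field_simps)
    with n(2) show "\<exists>n. True \<and> (N < n \<and> c / 2 * sum f {1..n} \<le> sum f ({N<..n} \<inter> B k))"
      by blast
  qed simp
  then obtain N :: "nat \<Rightarrow> nat" where N: "\<And>k. N k < N (Suc k)"
    "\<And>k. c / 2 * sum f {1..N (Suc k)} \<le> sum f ({N k<..N (Suc k)} \<inter> B k)"
    by blast
  have mono: "strict_mono N" using N(1) by (simp add: strict_mono_Suc_iff)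
  define A where "A = (\<Union>k. {N k<..N (Suc k)} \<inter> B k)"
  have "A \<subseteq> {1..}" by (auto simp: A_def)
  moreover have "A \<notin> Exh (weight_submeasure f)"
  proof
    assume "A \<in> Exh (weight_submeasure f)"
    then have "(\<lambda>n. weight_submeasure f (A - {1..n})) \<longlonglongrightarrow> 0" by (simp add: Exh_def)
    moreover have "c / 2 > 0" using \<open>c > 0\<close> by simp
    ultimately have "\<forall>\<^sub>F n in sequentially. weight_submeasure f (A - {1..n}) < c / 2"
      by (rule order_tendstoD(2))
    then obtain k where k: "\<And>n. n \<ge> k \<Longrightarrow> weight_submeasure f (A - {1..n}) < c / 2"
      unfolding eventually_sequentially by blast
    let ?n = "N (Suc k)"
    have "?n \<ge> 1" using N(1)[of k] by linarith
    have "0 < sum f {1..?n}"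
      using \<open>?n \<ge> 1\<close> by (intro sum_pos) (auto intro: pos)
    have "c / 2 * sum f {1..?n} \<le> sum f ({N k<..?n} \<inter> B k)" by (rule N(2))
    also have "\<dots> \<le> sum f ({1..?n} \<inter> (A - {1..N k}))"
      by (rule sum_mono_subset) (auto simp: A_def)
    finally have "c / 2 \<le> sum f ({1..?n} \<inter> (A - {1..N k})) / sum f {1..?n}"
      using \<open>0 < sum f {1..?n}\<close> by (simp add: le_divide_eq)
    also have "\<dots> \<le> weight_submeasure f (A - {1..N k})"
      using \<open>?n \<ge> 1\<close> by (rule ratio_le_weight_submeasure)
    finally show False using k[OF strict_mono_imp_increasing[OF mono]] by (simp add: not_less[symmetric])
  qed
  moreover have "finite (A - B k)" for k
  proof (rule finite_subset)
    have B: "B j \<subseteq> B k" if "k \<le> j" for j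
      using that decreasing by (rule lift_Suc_antimono_le[of B, rotated])
    show "A - B k \<subseteq> {..N k}"
    proof
      fix n assume n: "n \<in> A - B k"
      then obtain j where j: "n \<le> N (Suc j)" "n \<in> B j" by (auto simp: A_def)
      then have "\<not> k \<le> j" using B n by blast
      then have "N (Suc j) \<le> N k" by (intro strict_mono_leD[OF mono]) simp
      with j show "n \<in> {..N k}" by simp
    qed
  qed simp
  ultimately show ?thesis by blast
qed

text \<open>It is essential that \<open>c\<close> does not depend on \<open>\<epsilon>\<close>: with densities that are positive for every
  \<open>\<epsilon>\<close> but tend to \<open>0\<close>, the point would in general be a cluster point of the ideal only.\<close>

lemma ideal_limit_pointI:
  fixes y :: "nat \<Rightarrow> 'a::metric_space"
  assumes "c > 0"
    and dense: "\<And>\<epsilon>. \<epsilon> > 0 \<Longrightarrow>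
      \<exists>\<^sub>F n in sequentially. c * sum f {1..n} \<le> sum f ({1..n} \<inter> {k. y k \<in> ball l \<epsilon>})"
  shows "l \<in> ideal_limit_points (Exh (weight_submeasure f)) y"
proof -
  have "\<exists>A\<subseteq>{1..}. A \<notin> Exh (weight_submeasure f) \<and>
      (\<forall>k. finite (A - {n. y n \<in> ball l (1 / Suc k)}))"
  proof (rule ex_almost_subset_not_in_Exh[OF \<open>c > 0\<close>])
    show "{n. y n \<in> ball l (1 / Suc (Suc k))} \<subseteq> {n. y n \<in> ball l (1 / Suc k)}" for k
    proof -
      have "1 / real (Suc (Suc k)) \<le> 1 / real (Suc k)" by (simp add: field_simps)
      then show ?thesis by auto
    qed
    show "\<exists>\<^sub>F n in sequentially. c * sum f {1..n} \<le> sum f ({1..n} \<inter> {n. y n \<in> ball l (1 / Suc k)})" for k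
      by (rule dense) simp
  qed
  then obtain A where A: "A \<subseteq> {1..}" "A \<notin> Exh (weight_submeasure f)"
    "\<And>k. finite (A - {n. y n \<in> ball l (1 / Suc k)})"
    by blast
  have "infinite A" using A(1,2) finite_in_Exh by blast
  have "finite (A - {n. y n \<in> ball l \<epsilon>})" if \<epsilon>: "\<epsilon> > 0" for \<epsilon>
  proof -
    obtain k where k: "inverse (real (Suc k)) < \<epsilon>" using reals_Archimedean[OF \<epsilon>] by blast
    show ?thesis
      by (rule finite_subset[OF _ A(3)[of k]]) (use k in \<open>auto simp: inverse_eq_divide\<close>)
  qed
  with \<open>infinite A\<close> A(1) have "(\<lambda>k. y (enumerate A (k - 1))) \<longlonglongrightarrow> l"
    by (rule almost_subset_imp_convergent_enumeration)
  then show ?thesis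
    using index_sequence_enumerate[OF \<open>infinite A\<close> A(1)] A(2)
    unfolding ideal_limit_points_def by (intro CollectI exI[of _ "\<lambda>k. enumerate A (k - 1)"]) simp
qed

section \<open>Generic subsequences\<close>

text \<open>An infinite set of digits is modified beyond \<open>p\<close> so as to select exactly the elements of \<open>E\<close> from there
  on. At most \<open>p + 1\<close> positions of the new enumeration can then lie outside \<open>E\<close>, and they have
  bounded weight, while the total weight diverges. The condition up to position \<open>n\<close> depends only on the
  first \<open>n\<close> selected indices, hence on finitely many digits.

  The parameter \<open>m\<close> serves to obtain, by intersecting over all \<open>m\<close>, infinitely many such \<open>n\<close>.\<close>

lemma nowhere_dense_sparse_selection:
  assumes "infinite E" "E \<subseteq> {1..}"
  shows "nowhere_dense_in (top_of_set {0<..1}) {\<omega>\<in>{0<..1}. \<not> (\<exists>n\<ge>m. 1 / 2 * sum f {1..n} \<le>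
    sum f ({1..n} \<inter> {k. enumerate (dyadic_support \<omega>) (k - 1) \<in> E}))}"
proof (rule nowhere_dense_dyadic_support)
  fix S :: "nat set"
  assume S: "infinite S"
    "\<exists>n\<ge>m. 1 / 2 * sum f {1..n} \<le> sum f ({1..n} \<inter> {k. enumerate S (k - 1) \<in> E})"
  then obtain n where n: "n \<ge> m"
    "1 / 2 * sum f {1..n} \<le> sum f ({1..n} \<inter> {k. enumerate S (k - 1) \<in> E})"
    by blast
  have "{1..n} \<inter> {k. enumerate T (k - 1) \<in> E} = {1..n} \<inter> {k. enumerate S (k - 1) \<in> E}"
    if "infinite T" "T \<inter> {..enumerate S n} = S \<inter> {..enumerate S n}" for T
    using enumerate_eq_initial[OF S(1) that] by auto
  with n show "\<exists>p. \<forall>T. infinite T \<longrightarrow> T \<inter> {..p} = S \<inter> {..p} \<longrightarrow>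
      (\<exists>n\<ge>m. 1 / 2 * sum f {1..n} \<le> sum f ({1..n} \<inter> {k. enumerate T (k - 1) \<in> E}))"
    by metis
next
  fix S :: "nat set" and p
  assume S: "infinite S" "S \<subseteq> {1..}"
  define T where "T = S \<inter> {..p} \<union> E \<inter> {p<..}"
  have "infinite (E - {..p})" using assms(1) by (rule Diff_infinite_finite[rotated]) simp
  moreover have "E - {..p} = E \<inter> {p<..}" by auto
  ultimately have "infinite T" by (simp add: T_def)
  have in_E: "enumerate T (k - 1) \<in> E" if "k > Suc p" for k
  proof -
    have "p < enumerate T (k - 1)"
      using le_enumerate[OF \<open>infinite T\<close>, of "k - 1"] that by linarith
    with enumerate_in_set[OF \<open>infinite T\<close>, of "k - 1"] show ?thesis by (auto simp: T_def)
  qed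
  have "\<forall>\<^sub>F n in sequentially. n \<ge> m \<and> n \<ge> Suc p \<and> 2 * sum f {1..Suc p} \<le> sum f {1..n}"
    using divergent eventually_ge_at_top[of m] eventually_ge_at_top[of "Suc p"]
    unfolding filterlim_at_top by (intro eventually_conj) auto
  then obtain n where n: "n \<ge> m" "n \<ge> Suc p" "2 * sum f {1..Suc p} \<le> sum f {1..n}"
    using eventually_happens'[OF sequentially_bot] by blast
  have "sum f {1..n} = sum f {1..Suc p} + sum f {Suc p<..n}"
    using n(2) by (subst sum.union_disjoint[symmetric]) (auto intro!: sum.cong)
  moreover have "sum f {Suc p<..n} \<le> sum f ({1..n} \<inter> {k. enumerate T (k - 1) \<in> E})"
    using in_E by (intro sum_mono_subset) auto
  ultimately have "1 / 2 * sum f {1..n} \<le> sum f ({1..n} \<inter> {k. enumerate T (k - 1) \<in> E})"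
    using n(3) by linarith
  moreover have "T \<subseteq> {1..}" "T \<inter> {..p} = S \<inter> {..p}"
    using S(2) assms(2) by (auto simp: T_def)
  ultimately show "\<exists>T. infinite T \<and> T \<subseteq> {1..} \<and> T \<inter> {..p} = S \<inter> {..p} \<and>
      (\<exists>n\<ge>m. 1 / 2 * sum f {1..n} \<le> sum f ({1..n} \<inter> {k. enumerate T (k - 1) \<in> E}))"
    using \<open>infinite T\<close> n(1) by blast
qed

text \<open>Countably many balls suffice for all limit points at once, although \<open>limit_points x\<close> may be
  uncountable: each ball around a limit point contains a ball \<open>ball c (1 / (q + 1))\<close> from the countable
  family that still contains a smaller ball around the limit point, and hence \<open>x n\<close> for
  infinitely many \<open>n\<close>.\<close>

lemma meager_not_limit_points_subset:
  fixes x :: "nat \<Rightarrow> 'a::metric_space"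
  assumes "separable_space (euclidean :: 'a topology)"
  shows "meager_in (top_of_set {0<..1}) {\<omega>\<in>{0<..1}.
    \<not> limit_points x \<subseteq> ideal_limit_points (Exh (weight_submeasure f)) (dyadic_subseq x \<omega>)}"
proof -
  obtain C :: "'a set" where C: "countable C" "closure C = UNIV"
    using assms by (auto simp: separable_space_def)
  define E where "E = (\<lambda>c q. {n\<in>{1..}. x n \<in> ball c (1 / Suc q)})"
  define R where "R = (\<lambda>\<omega> (c, q) m. \<exists>n\<ge>m. 1 / 2 * sum f {1..n} \<le>
    sum f ({1..n} \<inter> {k. enumerate (dyadic_support \<omega>) (k - 1) \<in> E c q}))"
  define P where "P = {(c, q). c \<in> C \<and> infinite (E c q)}"
  define M where "M = (\<Union>(b, m)\<in>P \<times> UNIV. {\<omega>\<in>{0<..1}. \<not> R \<omega> b m})"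
  have "P \<subseteq> C \<times> UNIV" by (auto simp: P_def)
  then have "countable P" by (rule countable_subset) (simp add: C(1))
  moreover have "nowhere_dense_in (top_of_set {0<..1}) {\<omega>\<in>{0<..1}. \<not> R \<omega> b m}"
    if "b \<in> P" for b m
  proof -
    obtain c q where b: "b = (c, q)" by (cases b)
    then have "infinite (E c q)" using that by (simp add: P_def)
    moreover have "E c q \<subseteq> {1..}" by (auto simp: E_def)
    ultimately show ?thesis
      unfolding R_def b prod.case by (rule nowhere_dense_sparse_selection)
  qed
  ultimately have "meager_in (top_of_set {0<..1}) M"
    unfolding meager_in_def M_def
    by (intro exI[of _ "(\<lambda>(b, m). {\<omega>\<in>{0<..1}. \<not> R \<omega> b m}) ` (P \<times> UNIV)"]) auto
  then show ?thesis
  proof (rule meager_in_subset, intro subsetI)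
    fix \<omega> assume *: "\<omega> \<in> {\<omega>\<in>{0<..1}.
      \<not> limit_points x \<subseteq> ideal_limit_points (Exh (weight_submeasure f)) (dyadic_subseq x \<omega>)}"
    show "\<omega> \<in> M"
    proof (rule ccontr)
      assume "\<omega> \<notin> M"
      then have R: "R \<omega> b m" if "b \<in> P" for b m
        using * that by (auto simp: M_def)
      have "l \<in> ideal_limit_points (Exh (weight_submeasure f)) (dyadic_subseq x \<omega>)"
        if l: "l \<in> limit_points x" for l
      proof (rule ideal_limit_pointI)
        fix \<epsilon> :: real assume "\<epsilon> > 0"
        then obtain q where q: "inverse (real (Suc q)) < \<epsilon> / 2"
          using reals_Archimedean[of "\<epsilon> / 2"] by auto
        have "l \<in> closure C" using C(2) by simp
        moreover have "1 / (2 * real (Suc q)) > 0" by simp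
        ultimately obtain c where c: "c \<in> C" "dist c l < 1 / (2 * real (Suc q))"
          unfolding closure_approachable by blast
        have half: "1 / (2 * real (Suc q)) + 1 / (2 * real (Suc q)) = 1 / Suc q"
          by (simp add: field_simps)
        have "ball l (1 / (2 * real (Suc q))) \<subseteq> ball c (1 / Suc q)"
        proof
          fix z assume "z \<in> ball l (1 / (2 * real (Suc q)))"
          then show "z \<in> ball c (1 / Suc q)"
            using dist_triangle[of c z l] c(2) half by simp
        qed
        then have "{n\<in>{1..}. x n \<in> ball l (1 / (2 * real (Suc q)))} \<subseteq> E c q"
          unfolding E_def by blast
        moreover have "infinite {n\<in>{1..}. x n \<in> ball l (1 / (2 * real (Suc q)))}"
          using l \<open>1 / (2 * real (Suc q)) > 0\<close> unfolding limit_points_iff_infinite_ball by blast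
        ultimately have "(c, q) \<in> P"
          using c(1) finite_subset by (auto simp: P_def)
        have "ball c (1 / Suc q) \<subseteq> ball l \<epsilon>"
        proof
          fix z assume "z \<in> ball c (1 / Suc q)"
          moreover have "1 / (2 * real (Suc q)) \<le> 1 / Suc q" by (simp add: field_simps)
          ultimately show "z \<in> ball l \<epsilon>"
            using dist_triangle[of l z c] c(2) q by (simp add: dist_commute inverse_eq_divide)
        qed
        then have sub: "{k. enumerate (dyadic_support \<omega>) (k - 1) \<in> E c q} \<subseteq>
            {k. dyadic_subseq x \<omega> k \<in> ball l \<epsilon>}"
          by (auto simp: E_def dyadic_subseq_def dyadic_support_def)
        show "\<exists>\<^sub>F n in sequentially. 1 / 2 * sum f {1..n} \<le>
            sum f ({1..n} \<inter> {k. dyadic_subseq x \<omega> k \<in> ball l \<epsilon>})"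
          unfolding frequently_sequentially
        proof
          fix m
          obtain n where n: "n \<ge> m" "1 / 2 * sum f {1..n} \<le>
              sum f ({1..n} \<inter> {k. enumerate (dyadic_support \<omega>) (k - 1) \<in> E c q})"
            using R[OF \<open>(c, q) \<in> P\<close>, of m] unfolding R_def by blast
          note n(2)
          also have "sum f ({1..n} \<inter> {k. enumerate (dyadic_support \<omega>) (k - 1) \<in> E c q}) \<le>
              sum f ({1..n} \<inter> {k. dyadic_subseq x \<omega> k \<in> ball l \<epsilon>})"
            using sub by (intro sum_mono_subset) auto
          finally show "\<exists>n\<ge>m. 1 / 2 * sum f {1..n} \<le>
              sum f ({1..n} \<inter> {k. dyadic_subseq x \<omega> k \<in> ball l \<epsilon>})"
            using n(1) by blast
        qed
      qed simp
      with * show False by blast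
    qed
  qed
qed

end

text \<open>A value other than \<open>L\<close> occurs only within the exceptional set, and the points with value \<open>L\<close> form
  its complement; by Baire, the interval is not the union of two meager sets.\<close>

lemma not_meager_iff_generic_value:
  assumes "meager_in (top_of_set {0<..1::real}) {\<omega>\<in>{0<..1}. g \<omega> \<noteq> L}"
  shows "\<not> meager_in (top_of_set {0<..1}) {\<omega>\<in>{0<..1}. g \<omega> = K} \<longleftrightarrow> K = L"
proof
  assume "\<not> meager_in (top_of_set {0<..1}) {\<omega>\<in>{0<..1}. g \<omega> = K}"
  moreover have "{\<omega>\<in>{0<..1}. g \<omega> = K} \<subseteq> {\<omega>\<in>{0<..1}. g \<omega> \<noteq> L}" if "K \<noteq> L"
    using that by auto
  ultimately show "K = L" using meager_in_subset[OF assms] by blast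
next
  assume "K = L"
  then have "{\<omega>\<in>{0<..1}. g \<omega> = K} \<union> {\<omega>\<in>{0<..1}. g \<omega> \<noteq> L} = {0<..1}" by auto
  then show "\<not> meager_in (top_of_set {0<..1}) {\<omega>\<in>{0<..1}. g \<omega> = K}"
    using meager_in_Un[OF _ assms] not_meager_half_open_interval by metis
qed

theorem corollary2p4:
  fixes x :: "nat \<Rightarrow> 'a::metric_space" and I :: "nat set set"
  assumes "separable_space (euclidean :: 'a topology)"
    and "erdos_ulam_ideal I"
  shows "(\<not> meager_in (top_of_set {0<..1::real})
            {\<omega> \<in> {0<..1}. cluster_points I (dyadic_subseq x \<omega>) = cluster_points I x}
         \<longleftrightarrow> cluster_points I x = limit_points x) \<and>
         (\<not> meager_in (top_of_set {0<..1::real})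
            {\<omega> \<in> {0<..1}. ideal_limit_points I (dyadic_subseq x \<omega>) = ideal_limit_points I x}
         \<longleftrightarrow> ideal_limit_points I x = limit_points x)"
proof -
  obtain f where f: "\<And>n. n \<ge> 1 \<Longrightarrow> f n > 0"
    "filterlim (\<lambda>n. sum f {1..n}) at_top sequentially" "I = Exh (weight_submeasure f)"
    using assms(2) unfolding erdos_ulam_ideal_def by blast
  interpret divergent_weight f
    using f by unfold_locales auto
  have chain: "ideal_limit_points I (dyadic_subseq x \<omega>) \<subseteq> cluster_points I (dyadic_subseq x \<omega>)"
    "cluster_points I (dyadic_subseq x \<omega>) \<subseteq> limit_points x" if "\<omega> \<in> {0<..1}" for \<omega>
  proof -
    show "ideal_limit_points I (dyadic_subseq x \<omega>) \<subseteq> cluster_points I (dyadic_subseq x \<omega>)"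
      unfolding f(3) by (rule ideal_limit_points_subset_cluster_points)
    have "limit_points (dyadic_subseq x \<omega>) \<subseteq> limit_points x"
      using limit_points_compose_subset[OF index_sequence_enumerate(1)
          [OF infinite_dyadic_support[OF that] dyadic_support_positive[OF that]], of x]
      by (simp add: dyadic_subseq_def[abs_def] dyadic_support_def)
    then show "cluster_points I (dyadic_subseq x \<omega>) \<subseteq> limit_points x"
      using cluster_points_subset_limit_points unfolding f(3) by blast
  qed
  note M = meager_not_limit_points_subset[OF assms(1), of x, folded f(3)]
  show ?thesis
  proof (intro conjI not_meager_iff_generic_value)
    show "meager_in (top_of_set {0<..1})
        {\<omega>\<in>{0<..1}. cluster_points I (dyadic_subseq x \<omega>) \<noteq> limit_points x}"
      by (rule meager_in_subset[OF M]) (use chain in blast)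
    show "meager_in (top_of_set {0<..1})
        {\<omega>\<in>{0<..1}. ideal_limit_points I (dyadic_subseq x \<omega>) \<noteq> limit_points x}"
      by (rule meager_in_subset[OF M]) (use chain in blast)
  qed
qed

end
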